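(* In the finite-dimensional setting of the context, let $(\boldsymbol\psi_1,\lambda_1)$, $(\boldsymbol\psi_2,\lambda_2)$ and $(\boldsymbol\psi_3,\lambda_3)$ be three eigenpairs of $\mathbb G$, $\mathbb G\boldsymbol\psi_j=\lambda_j\boldsymbol\psi_j$, such that $0<|\lambda_3|<|\lambda_2|\le|\lambda_1|$ and $\|\boldsymbol\psi_j\|_2=1$ for $j=1,2$, and denote by $\widetilde\lambda_j$ the eigenvalues of $\mathbb A$ corresponding to $\boldsymbol\psi_j$. Assume that both $\lambda_j$ and $\widetilde\lambda_j$ are real for $j=1,2$ and $\widetilde\lambda_1\widetilde\lambda_2>0$. Define $V_c:=\mathrm{span}\{\boldsymbol\psi_1+\varepsilon\boldsymbol\psi_2\}$ with $\varepsilon\in\mathbb R$, and $\gamma:=\langle\boldsymbol\psi_1,\boldsymbol\psi_2\rangle\in[-1,1]$. Let $\widetilde T(\varepsilon)$ be the matrix representation of the corresponding two-level operator (see context). Then: (A) The spectral radius of $\widetilde T(\varepsilon)$ is $\rho(\widetilde T(\varepsilon))=\max\{|\lambda(\varepsilon,\gamma)|,|\lambda_3|\}$, where $$\lambda(\varepsilon,\gamma)=\frac{\lambda_1\widetilde\lambda_2\varepsilon^2+\gamma(\lambda_1\widetilde\lambda_2+\lambda_2\widetilde\lambda_1)\varepsilon+\lambda_2\widetilde\lambda_1}{\widetilde\lambda_2\varepsilon^2+\gamma(\widetilde\lambda_1+\widetilde\lambda_2)\varepsilon+\widetilde\lambda_1}.$$ (B) Let $\gamma=0$. If $\lambda_1>\lambda_2>0$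 or $0>\lambda_2>\lambda_1$, then $\min_{\varepsilon\in\mathbb R}\rho(\widetilde T(\varepsilon))=\rho(\widetilde T(0))$. (C) Let $\gamma=0$. If $\lambda_2>0>\lambda_1$ or $\lambda_1>0>\lambda_2$, then there exists an $\widetilde\varepsilon\ne0$ such that $\rho(\widetilde T(\widetilde\varepsilon))=|\lambda_3|=\min_{\varepsilon\in\mathbb R}\rho(\widetilde T(\varepsilon))<\rho(\widetilde T(0))$. (D) Let $\gamma\ne0$. If $\lambda_1>\lambda_2>0$ or $0>\lambda_2>\lambda_1$, then there exists an $\widetilde\varepsilon\neq0$ such that $|\lambda(\widetilde\varepsilon,\gamma)|<|\lambda_2|$ and hence $\rho(\widetilde T(\widetilde\varepsilon))=\max\{|\lambda(\widetilde\varepsilon,\gamma)|,|\lambda_3|\}<\rho(\widetilde T(0))$. (E) Let $\gamma\ne0$. If $\lambda_2>0>\lambda_1$ or $\lambda_1>0>\lambda_2$, then there exists an $\widetilde\varepsilon\neq0$ such that $\rho(\widetilde T(\widetilde\varepsilon))=|\lambda_3|=\min_{\varepsilon\in\mathbb R}\rho(\widetilde T(\varepsilon))<\rho(\widetilde T(0))$. (F) The map $\gamma\mapsto\lambda(\varepsilon,\gamma)$ (defined by the formula in (A)) has a vertical asymptote at $\gamma^*(\varepsilon)=-\frac{\varepsilon^2\widetilde\lambda_2+\widetilde\lambda_1}{\varepsilon(\widetilde\lambda_1+\widetilde\lambda_2)}$ for any $$\varepsilon^2\neq-\frac{(\lambda_2\widetilde\lambda_1)(\widetilde\lambda_1+\widetilde\lambda_2)}{\lambda_1\widetilde\lambda_2^2+\widetilde\lambda_1^2\lambda_2}.$$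 Thus there exists a neighborhood $I(\gamma^* )$ such that for all $\gamma\in I(\gamma^* )$, $\lambda(\varepsilon,\gamma)\notin(-1,1)$.
   Context: Setting: $\mathcal X=\mathbb C^N$ ($N\ge3$) with inner product $\langle\cdot,\cdot\rangle$ (linear in the second argument) and induced norm $\|\cdot\|_2$; $\mathbb A\in\mathbb C^{N\times N}$ is invertible, $\mathbb G\in\mathbb C^{N\times N}$, and $\mathbb I$ is the identity; $\mathbb A$ and $\mathbb G$ have the same linearly independent eigenvectors $\boldsymbol\psi_1,\dots,\boldsymbol\psi_N$, with eigenvalues $\widetilde\lambda_k$ of $\mathbb A$ and $\lambda_k$ of $\mathbb G$, satisfying $|\lambda_k|\in(0,1)$ and $|\lambda_k|\le|\lambda_{k-1}|$. The three eigenpairs in the claim are those with indices $1,2,3$ in this numbering. For $\varepsilon\in\mathbb R$, put $\mathbf p:=\boldsymbol\psi_1+\varepsilon\boldsymbol\psi_2$, $P:\mathbb C\to\mathcal X$, $Pz:=z\,\mathbf p$, $R:\mathcal X\to\mathbb C$, $R\mathbf f:=\langle\mathbf p,\mathbf f\rangle$, and $\mathbb A_c:=R\mathbb AP\in\mathbb C$. The coarse operator $\mathbb A_c$ is assumed to be invertible throughout (i.e. $\widetilde T(\varepsilon)$ is considered for those $\varepsilon$ with $\mathbb A_c\ne0$). The two-level operator is $\mathbb T:=(\mathbb I-P\mathbb A_c^{-1}R\mathbb A)\mathbb G$, and $\widetilde T(\varepsilon)\in\mathbb C^{N\times N}$ is the matrix with entries $\widetilde t_{j,\ell}$ given by $\mathbb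 T\boldsymbol\psi_j=\sum_{\ell=1}^N\widetilde t_{j,\ell}\boldsymbol\psi_\ell$.
   Formalization: In (F), ε ≠ 0, ε² ≠ 1 and λ_1 ≠ λ_2 are assumed in addition (if ε² = 1 or λ_1 = λ_2, λ(ε,·) is constant off γ* and has no asymptote), and the neighborhood I(γ* ) omits the point γ* itself, where λ is undefined. *)

theory Defs
  imports
    "HOL-Analysis.Analysis"
    "Jordan_Normal_Form.Spectral_Radius"
    "Jordan_Normal_Form.VS_Connect"
begin

text \<open>
  The space \<open>\<complex>\<^sup>N\<close> is \<open>carrier_vec N\<close>. The inner product on it is arbitrary, linear in the second
  and conjugate-linear in the first argument (the latter follows from conjugate symmetry); the
  standard one is \<open>\<lambda>f g. g \<bullet>c f\<close>.
\<close>

definition complex_inner_product :: "nat \<Rightarrow> (complex vec \<Rightarrow> complex vec \<Rightarrow> complex) \<Rightarrow> bool" where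
  "complex_inner_product N ip \<longleftrightarrow>
     (\<forall>f\<in>carrier_vec N. \<forall>g\<in>carrier_vec N. \<forall>h\<in>carrier_vec N. ip f (g + h) = ip f g + ip f h) \<and>
     (\<forall>f\<in>carrier_vec N. \<forall>g\<in>carrier_vec N. \<forall>c. ip f (c \<cdot>\<^sub>v g) = c * ip f g) \<and>
     (\<forall>f\<in>carrier_vec N. \<forall>g\<in>carrier_vec N. ip g f = cnj (ip f g)) \<and>
     (\<forall>f\<in>carrier_vec N. f \<noteq> 0\<^sub>v N \<longrightarrow> 0 < Re (ip f f))"

definition induced_norm :: "(complex vec \<Rightarrow> complex vec \<Rightarrow> complex) \<Rightarrow> complex vec \<Rightarrow> real" where
  "induced_norm ip f = sqrt (Re (ip f f))"

text \<open>
  A family \<open>psi\<close> of vectors is indexed by \<open>1, \<dots>, N\<close>. Linear independence is a property of sets in the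
  library, so it is combined with injectivity.
\<close>

definition lin_indep_family :: "nat \<Rightarrow> (nat \<Rightarrow> complex vec) \<Rightarrow> bool" where
  "lin_indep_family N psi \<longleftrightarrow>
     psi ` {1..N} \<subseteq> carrier_vec N \<and> inj_on psi {1..N} \<and>
     \<not> LinearCombinations.module.lin_dep class_ring (module_vec TYPE(complex) N) (psi ` {1..N})"

text \<open>The vector \<open>p\<close> spanning the coarse space \<open>V\<^sub>c\<close>, which is the range of \<open>prolongation p\<close>.\<close>

definition coarse_vec :: "(nat \<Rightarrow> complex vec) \<Rightarrow> real \<Rightarrow> complex vec" where
  "coarse_vec psi \<epsilon> = psi 1 + complex_of_real \<epsilon> \<cdot>\<^sub>v psi 2"

definition prolongation :: "complex vec \<Rightarrow> complex \<Rightarrow> complex vec" where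
  "prolongation p z = z \<cdot>\<^sub>v p"

definition restriction ::
  "(complex vec \<Rightarrow> complex vec \<Rightarrow> complex) \<Rightarrow> complex vec \<Rightarrow> complex vec \<Rightarrow> complex" where
  "restriction ip p f = ip p f"

text \<open>\<open>R A P\<close> is a linear map from \<open>\<complex>\<close> to \<open>\<complex>\<close>; it is identified with its value at \<open>1\<close>.\<close>

definition coarse_matrix ::
  "(complex vec \<Rightarrow> complex vec \<Rightarrow> complex) \<Rightarrow> complex mat \<Rightarrow> complex vec \<Rightarrow> complex" where
  "coarse_matrix ip A p = restriction ip p (A *\<^sub>v prolongation p 1)"

definition two_level_op ::
  "(complex vec \<Rightarrow> complex vec \<Rightarrow> complex) \<Rightarrow> complex mat \<Rightarrow> complex mat \<Rightarrow> complex vec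
    \<Rightarrow> complex vec \<Rightarrow> complex vec" where
  "two_level_op ip A G p f =
     (let g = G *\<^sub>v f
      in g - prolongation p (inverse (coarse_matrix ip A p) * restriction ip p (A *\<^sub>v g)))"

text \<open>
  Matrix of \<open>T\<close> with respect to a basis \<open>psi 1, \<dots>, psi N\<close>: row \<open>j\<close> holds the coefficients of
  \<open>T (psi j)\<close>. Matrix indices start at \<open>0\<close>.
\<close>

definition matrix_rep ::
  "nat \<Rightarrow> (nat \<Rightarrow> complex vec) \<Rightarrow> (complex vec \<Rightarrow> complex vec) \<Rightarrow> complex mat" where
  "matrix_rep N psi T =
     (THE M. M \<in> carrier_mat N N \<and>
        (\<forall>j\<in>{1..N}. T (psi j) =
           finsum_vec TYPE(complex) N (\<lambda>l. M $$ (j - 1, l - 1) \<cdot>\<^sub>v psi l) {1..N}))"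

definition two_level_matrix ::
  "nat \<Rightarrow> (complex vec \<Rightarrow> complex vec \<Rightarrow> complex) \<Rightarrow> complex mat \<Rightarrow> complex mat
    \<Rightarrow> (nat \<Rightarrow> complex vec) \<Rightarrow> real \<Rightarrow> complex mat" where
  "two_level_matrix N ip A G psi \<epsilon> = matrix_rep N psi (two_level_op ip A G (coarse_vec psi \<epsilon>))"

text \<open>The coarse operator is invertible; \<open>two_level_matrix\<close> is meaningful only for such \<open>\<epsilon>\<close>.\<close>

definition admissible ::
  "(complex vec \<Rightarrow> complex vec \<Rightarrow> complex) \<Rightarrow> complex mat \<Rightarrow> (nat \<Rightarrow> complex vec) \<Rightarrow> real \<Rightarrow> bool" where
  "admissible ip A psi \<epsilon> \<longleftrightarrow> coarse_matrix ip A (coarse_vec psi \<epsilon>) \<noteq> 0"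

text \<open>Here \<open>l1, l2\<close> are eigenvalues of \<open>G\<close> and \<open>m1, m2\<close> the corresponding eigenvalues of \<open>A\<close>.\<close>

definition lambda_fun :: "real \<Rightarrow> real \<Rightarrow> real \<Rightarrow> real \<Rightarrow> real \<Rightarrow> real \<Rightarrow> real" where
  "lambda_fun l1 l2 m1 m2 \<epsilon> \<gamma> =
     (l1 * m2 * \<epsilon>\<^sup>2 + \<gamma> * (l1 * m2 + l2 * m1) * \<epsilon> + l2 * m1) /
     (m2 * \<epsilon>\<^sup>2 + \<gamma> * (m1 + m2) * \<epsilon> + m1)"

text \<open>
  The pole of \<open>\<gamma> \<mapsto> lambda_fun l1 l2 m1 m2 \<epsilon> \<gamma>\<close>, for \<open>\<epsilon> \<noteq> 0\<close>. The numerator takes the value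
  \<open>m1 * m2 * (l1 - l2) * (\<epsilon>\<^sup>2 - 1) / (m1 + m2)\<close> there, so if \<open>l1 = l2\<close> or \<open>\<epsilon>\<^sup>2 = 1\<close> it cancels with the
  denominator and the map is constant away from that point.
\<close>

definition gamma_star :: "real \<Rightarrow> real \<Rightarrow> real \<Rightarrow> real" where
  "gamma_star m1 m2 \<epsilon> = - ((\<epsilon>\<^sup>2 * m2 + m1) / (\<epsilon> * (m1 + m2)))"

end

theory Submission
  imports Defs "HOL-Library.Quadratic_Discriminant"
begin

text \<open>
  The coarse correction only subtracts multiples of \<open>p = \<psi>\<^sub>1 + \<epsilon> \<psi>\<^sub>2\<close>. Hence in the eigenbasis every
  row of the matrix of the two-level operator \<open>T\<close> agrees with the diagonal matrix of the \<open>\<lambda>\<^sub>k\<close> except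
  in the first two columns: the matrix is block lower triangular, with a \<open>2 \<times> 2\<close> block for
  \<open>span {\<psi>\<^sub>1, \<psi>\<^sub>2}\<close> and the diagonal entries \<open>\<lambda>\<^sub>3, \<dots>, \<lambda>\<^sub>N\<close>. On that span \<open>T\<close> is \<open>G\<close> followed by a
  projection with kernel spanned by \<open>p\<close>; so the block is singular and its other eigenvalue is its trace,
  which works out to \<open>\<lambda>(\<epsilon>,\<gamma>)\<close>. Since \<open>\<bar>\<lambda>\<^sub>3\<bar>\<close> dominates the remaining diagonal entries, the spectral
  radius is \<open>max \<bar>\<lambda>(\<epsilon>,\<gamma>)\<bar> \<bar>\<lambda>\<^sub>3\<bar>\<close> (\<open>spectral_radius_two_level_matrix\<close>).

  The remaining claims concern the rational function \<open>\<lambda>(\<epsilon>,\<gamma>)\<close>, whose value at \<open>\<epsilon> = 0\<close> is \<open>\<lambda>\<^sub>2\<close>.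
  For \<open>\<gamma> = 0\<close> it is a convex combination of \<open>\<lambda>\<^sub>1\<close> and \<open>\<lambda>\<^sub>2\<close>, so if these have the same sign no
  choice of \<open>\<epsilon>\<close> beats \<open>\<epsilon> = 0\<close> (\<open>lambda_fun_orthogonal_lower_bound\<close>). For \<open>\<gamma> \<noteq> 0\<close> and
  \<open>\<lambda>\<^sub>1 \<noteq> \<lambda>\<^sub>2\<close> its derivative at \<open>\<epsilon> = 0\<close> does not vanish, so moving a little in the right direction decreases its modulus
  (\<open>lambda_fun_decrease_near_zero\<close>). If \<open>\<lambda>\<^sub>1\<close> and \<open>\<lambda>\<^sub>2\<close> have opposite signs, the numerator is a quadratic
  in \<open>\<epsilon>\<close> with coefficients of opposite sign at \<open>\<epsilon>\<^sup>2\<close> and \<open>1\<close>, so it has a real root, and there the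
  spectral radius attains its lower bound \<open>\<bar>\<lambda>\<^sub>3\<bar>\<close> (\<open>lambda_fun_nontrivial_zero\<close>). That the denominator
  does not vanish at this root needs \<open>\<bar>\<gamma>\<bar> < 1\<close>, the strict Cauchy--Schwarz inequality for the
  independent unit vectors \<open>\<psi>\<^sub>1, \<psi>\<^sub>2\<close> (\<open>unit_vectors_ip_square_less_1\<close>). Finally, numerator and
  denominator are affine in \<open>\<gamma>\<close>, and at \<open>\<gamma>\<^sup>*(\<epsilon>)\<close> only the denominator vanishes when \<open>\<epsilon>\<^sup>2 \<noteq> 1\<close> and
  \<open>\<lambda>\<^sub>1 \<noteq> \<lambda>\<^sub>2\<close> (\<open>lambda_fun_pole\<close>).
\<close>

section \<open>Spectrum of a block triangular matrix\<close>

lemma det_2x2: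
  fixes A :: "'a :: comm_ring_1 mat"
  assumes A: "A \<in> carrier_mat 2 2"
  shows "det A = A $$ (0,0) * A $$ (1,1) - A $$ (0,1) * A $$ (1,0)"
proof -
  have minor: "det (mat_delete A i 0) = A $$ (1 - i, 1)" if "i < 2" for i
    using that A by (subst det_single) (auto simp: mat_delete_def)
  have "det A = (\<Sum>i<2. A $$ (i,0) * cofactor A i 0)"
    by (rule laplace_expansion_column[OF A]) simp
  also have "\<dots> = A $$ (0,0) * A $$ (1,1) - A $$ (0,1) * A $$ (1,0)"
    by (simp add: numeral_2_eq_2 cofactor_def minor)
  finally show ?thesis .
qed

text \<open>
  The characteristic matrix is block lower triangular with a diagonal lower right block, so its
  determinant factors. The leading \<open>2 \<times> 2\<close> block is singular, so its characteristic polynomial is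
  \<open>k\<^sup>2 - trace \<cdot> k\<close>.
\<close>

lemma spectrum_singular_block_above_diagonal:
  fixes M :: "'a :: field mat"
  assumes M: "M \<in> carrier_mat N N" and N: "2 \<le> N"
    and off_diag: "\<And>i j. i < N \<Longrightarrow> 2 \<le> j \<Longrightarrow> j < N \<Longrightarrow> i \<noteq> j \<Longrightarrow> M $$ (i,j) = 0"
    and singular: "M $$ (0,0) * M $$ (1,1) = M $$ (0,1) * M $$ (1,0)"
  shows "spectrum M = {0, M $$ (0,0) + M $$ (1,1)} \<union> (\<lambda>j. M $$ (j,j)) ` {2..<N}"
proof -
  have "eigenvalue M k \<longleftrightarrow> k \<in> {0, M $$ (0,0) + M $$ (1,1)} \<union> (\<lambda>j. M $$ (j,j)) ` {2..<N}" for k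
  proof -
    define C where "C = char_matrix M k"
    have C_index: "C $$ (i,j) = M $$ (i,j) - (if i = j then k else 0)" if "i < N" "j < N" for i j
      using that M by (auto simp: C_def char_matrix_def)
    have C_carrier: "C \<in> carrier_mat N N" using M by (simp add: C_def)
    define B where "B = mat 2 2 (\<lambda>(i,j). C $$ (i,j))"
    define E where "E = mat (N - 2) 2 (\<lambda>(i,j). C $$ (i + 2,j))"
    define D where "D = mat (N - 2) (N - 2) (\<lambda>(i,j). C $$ (i + 2,j + 2))"
    have shift: "Suc (Suc (i - 2)) = i" if "\<not> i < 2" for i using that by simp
    have "C = four_block_mat B (0\<^sub>m 2 (N - 2)) E D"
      using C_carrier N
      by (intro eq_matI) (auto simp: B_def E_def D_def C_index off_diag shift simp flip: numeral_2_eq_2)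
    then have "det C = det B * det D"
      by (simp only:) (rule det_four_block_mat_upper_right_zero, auto simp: B_def E_def D_def)
    moreover have "det B = k * (k - (M $$ (0,0) + M $$ (1,1)))"
      using N singular by (subst det_2x2) (auto simp: B_def C_index algebra_simps)
    moreover have "det D = prod_list (diag_mat D)"
      using N by (intro det_lower_triangular[of "N - 2"]) (auto simp: D_def C_index off_diag)
    moreover have "diag_mat D = map (\<lambda>i. M $$ (i + 2, i + 2) - k) [0..<N - 2]"
      by (auto simp: diag_mat_def D_def C_index)
    moreover have "(\<exists>i < N - 2. M $$ (i + 2, i + 2) = k) \<longleftrightarrow> k \<in> (\<lambda>j. M $$ (j,j)) ` {2..<N}"
    proof
      assume "k \<in> (\<lambda>j. M $$ (j,j)) ` {2..<N}"
      then obtain j where "2 \<le> j" "j < N" "M $$ (j,j) = k" by auto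
      then show "\<exists>i < N - 2. M $$ (i + 2, i + 2) = k"
        by (intro exI[of _ "j - 2"]) (auto simp: shift)
    qed (force intro: image_eqI)
    ultimately have "det C = 0 \<longleftrightarrow>
        k \<in> {0, M $$ (0,0) + M $$ (1,1)} \<union> (\<lambda>j. M $$ (j,j)) ` {2..<N}"
      by (auto simp: prod_list_zero_iff image_iff)
    then show ?thesis by (simp add: eigenvalue_det[OF M] C_def)
  qed
  then show ?thesis by (auto simp: spectrum_def)
qed

section \<open>Matrix of a map with respect to a basis\<close>

text \<open>
  Linear independence is stated for the set of the \<open>\<psi>\<^sub>l\<close>; injectivity of the indexing turns a
  family of coefficients into a function on that set.
\<close>

lemma lin_indep_family_coeffs_unique:
  assumes indep: "lin_indep_family N psi"
    and eq: "finsum_vec TYPE(complex) N (\<lambda>l. a l \<cdot>\<^sub>v psi l) {1..N} =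
      finsum_vec TYPE(complex) N (\<lambda>l. b l \<cdot>\<^sub>v psi l) {1..N}"
    and l: "l \<in> {1..N}"
  shows "a l = b l"
proof -
  interpret vec_space "TYPE(complex)" N .
  from indep have sub: "psi ` {1..N} \<subseteq> carrier_vec N" and inj: "inj_on psi {1..N}"
    and li: "\<not> lin_dep (psi ` {1..N})"
    by (auto simp: lin_indep_family_def)
  define f where "f v = a (the_inv_into {1..N} psi v) - b (the_inv_into {1..N} psi v)" for v
  have f_psi: "f (psi k) = a k - b k" if "k \<in> {1..N}" for k
    using that inj by (simp add: f_def the_inv_into_f_f)
  have "lincomb f (psi ` {1..N}) = 0\<^sub>v N"
  proof (rule eq_vecI)
    fix i assume "i < dim_vec (0\<^sub>v N)"
    then have i: "i < N" by simp
    have comp: "finsum_vec TYPE(complex) N (\<lambda>l. c l \<cdot>\<^sub>v psi l) {1..N} $ i = (\<Sum>l\<in>{1..N}. c l * psi l $ i)" for c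
    proof -
      have "finsum_vec TYPE(complex) N (\<lambda>l. c l \<cdot>\<^sub>v psi l) {1..N} $ i = (\<Sum>l\<in>{1..N}. (c l \<cdot>\<^sub>v psi l) $ i)"
        by (rule index_finsum_vec) (use i sub in auto)
      also have "\<dots> = (\<Sum>l\<in>{1..N}. c l * psi l $ i)"
        using i sub by (intro sum.cong refl index_smult_vec) fastforce
      finally show ?thesis .
    qed
    have "lincomb f (psi ` {1..N}) $ i = (\<Sum>k\<in>{1..N}. f (psi k) * psi k $ i)"
      unfolding lincomb_index[OF i sub] sum.reindex[OF inj] by simp
    also have "\<dots> = (\<Sum>k\<in>{1..N}. a k * psi k $ i) - (\<Sum>k\<in>{1..N}. b k * psi k $ i)"
      by (simp add: f_psi left_diff_distrib sum_subtractf)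
    also have "\<dots> = 0" using eq comp[of a] comp[of b] by simp
    finally show "lincomb f (psi ` {1..N}) $ i = 0\<^sub>v N $ i" using i by simp
  qed (use lincomb_dim[OF _ sub] in simp)
  then have "f \<in> psi ` {1..N} \<rightarrow> {0}"
    using not_lindepD[OF li, of "psi ` {1..N}" f] by simp
  then have "f (psi l) = 0" using l by blast
  then show ?thesis using f_psi[OF l] by simp
qed

text \<open>
  Uniqueness of coefficients makes the definite description in \<open>matrix_rep\<close> well defined, so
  exhibiting one matrix with the right rows identifies it.
\<close>

lemma matrix_rep_eqI:
  assumes indep: "lin_indep_family N psi" and M: "M \<in> carrier_mat N N"
    and rows: "\<And>j. j \<in> {1..N} \<Longrightarrow>
      T (psi j) = finsum_vec TYPE(complex) N (\<lambda>l. M $$ (j - 1, l - 1) \<cdot>\<^sub>v psi l) {1..N}"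
  shows "matrix_rep N psi T = M"
  unfolding matrix_rep_def
proof (rule the_equality)
  fix M' assume M': "M' \<in> carrier_mat N N \<and> (\<forall>j\<in>{1..N}. T (psi j) =
      finsum_vec TYPE(complex) N (\<lambda>l. M' $$ (j - 1, l - 1) \<cdot>\<^sub>v psi l) {1..N})"
  show "M' = M"
  proof (rule eq_matI)
    fix i l assume "i < dim_row M" "l < dim_col M"
    then have "Suc i \<in> {1..N}" "Suc l \<in> {1..N}" using M by auto
    then have "M' $$ (Suc i - 1, Suc l - 1) = M $$ (Suc i - 1, Suc l - 1)"
      using M' rows[of "Suc i"]
      by (intro lin_indep_family_coeffs_unique[OF indep, where a = "\<lambda>l. M' $$ (Suc i - 1, l - 1)"]) auto
    then show "M' $$ (i,l) = M $$ (i,l)" by simp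
  qed (use M M' in auto)
qed (use M rows in auto)

text \<open>
  This is the shape of the expansion of \<open>T \<psi>\<^sub>j\<close>: a multiple of \<open>\<psi>\<^sub>j\<close> and a vector in
  \<open>span {\<psi>\<^sub>1, \<psi>\<^sub>2}\<close>. The index \<open>j\<close> may coincide with \<open>1\<close> or \<open>2\<close>, hence a sum of three
  conditionals in place of a case distinction.
\<close>

lemma finsum_vec_three_terms:
  fixes psi :: "nat \<Rightarrow> complex vec"
  assumes psi: "psi ` {1..N} \<subseteq> carrier_vec N" and N: "2 \<le> N" and j: "j \<in> {1..N}"
  shows "finsum_vec TYPE(complex) N
      (\<lambda>l. ((if l = j then d else 0) + (if l = 1 then x else 0) + (if l = 2 then y else 0)) \<cdot>\<^sub>v psi l) {1..N} =
    d \<cdot>\<^sub>v psi j + (x \<cdot>\<^sub>v psi 1 + y \<cdot>\<^sub>v psi 2)"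
    (is "finsum_vec _ _ ?v _ = ?rhs")
proof (rule eq_vecI)
  interpret vec_space "TYPE(complex)" N .
  have psi_dim: "dim_vec (psi l) = N" if "l \<in> {1..N}" for l using psi that by (intro carrier_vecD) blast
  have v: "?v \<in> {1..N} \<rightarrow> carrier_vec N" using psi by auto
  show "dim_vec (finsum_vec TYPE(complex) N ?v {1..N}) = dim_vec ?rhs"
    unfolding finsum_vec using finsum_dim[OF _ v] N by (simp add: psi_dim)
  fix i assume "i < dim_vec ?rhs"
  then have i: "i < N" using N by (simp add: psi_dim)
  have "finsum_vec TYPE(complex) N ?v {1..N} $ i = (\<Sum>l\<in>{1..N}. ?v l $ i)"
    by (rule index_finsum_vec[OF _ i v]) simp
  also have "\<dots> = (\<Sum>l\<in>{1..N}. (if l = j then d * psi l $ i else 0) +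
      (if l = 1 then x * psi l $ i else 0) + (if l = 2 then y * psi l $ i else 0))"
    using i by (intro sum.cong) (auto simp: psi_dim algebra_simps)
  also have "\<dots> = ?rhs $ i"
    using i N j by (simp add: sum.distrib sum.delta psi_dim)
  finally show "finsum_vec TYPE(complex) N ?v {1..N} $ i = ?rhs $ i" .
qed

section \<open>The rational function \<open>\<lambda>(\<epsilon>,\<gamma>)\<close>\<close>

text \<open>
  The denominator of \<open>\<lambda>(\<epsilon>,\<gamma>)\<close>. For unit vectors \<open>\<psi>\<^sub>1, \<psi>\<^sub>2\<close> with inner product \<open>\<gamma>\<close> it is the coarse
  operator \<open>A\<^sub>c\<close>, so admissible \<open>\<epsilon>\<close> are those where it does not vanish.
\<close>

definition coarse_denominator :: "real \<Rightarrow> real \<Rightarrow> real \<Rightarrow> real \<Rightarrow> real" where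
  "coarse_denominator m1 m2 \<epsilon> \<gamma> = m2 * \<epsilon>\<^sup>2 + \<gamma> * (m1 + m2) * \<epsilon> + m1"

lemma lambda_fun_at_zero: "m1 \<noteq> 0 \<Longrightarrow> lambda_fun l1 l2 m1 m2 0 \<gamma> = l2"
  by (simp add: lambda_fun_def)

text \<open>
  With \<open>m\<^sub>1\<close> and \<open>m\<^sub>2\<close> of the same sign, \<open>\<lambda>(\<epsilon>,0)\<close> is the average of \<open>l\<^sub>1\<close> and \<open>l\<^sub>2\<close> with weights
  proportional to \<open>m\<^sub>2 \<epsilon>\<^sup>2\<close> and \<open>m\<^sub>1\<close>, so it lies on the side of \<open>l\<^sub>2\<close> away from \<open>0\<close>.
\<close>

lemma lambda_fun_orthogonal_lower_bound:
  assumes "m1 * m2 > 0" and l: "(l1 > l2 \<and> l2 > 0) \<or> (0 > l2 \<and> l2 > l1)"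
  shows "\<bar>l2\<bar> \<le> \<bar>lambda_fun l1 l2 m1 m2 \<epsilon> 0\<bar>"
proof -
  define t where "t = m2 * \<epsilon>\<^sup>2 / (m2 * \<epsilon>\<^sup>2 + m1)"
  have "0 \<le> m1 * m2 * \<epsilon>\<^sup>2" using assms(1) by simp
  moreover have "0 < m1\<^sup>2" using assms(1) by (auto simp: zero_less_mult_iff)
  ultimately have pos: "0 < m1 * (m2 * \<epsilon>\<^sup>2 + m1)" by (simp add: algebra_simps power2_eq_square)
  then have nz: "m2 * \<epsilon>\<^sup>2 + m1 \<noteq> 0" by auto
  have "0 \<le> t" using assms(1) pos
    by (auto simp: t_def zero_less_mult_iff zero_le_divide_iff mult_nonneg_nonneg mult_nonpos_nonneg)
  moreover have "lambda_fun l1 l2 m1 m2 \<epsilon> 0 = l2 + t * (l1 - l2)"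
    using nz by (simp add: lambda_fun_def t_def field_simps)
  ultimately show ?thesis
    using l mult_nonneg_nonneg[of t "l1 - l2"] mult_nonneg_nonneg[of t "l2 - l1"]
    by (elim disjE) (simp_all add: right_diff_distrib)
qed

text \<open>
  As a quadratic in \<open>\<epsilon>\<close> the numerator has leading and constant coefficients of opposite sign, hence a
  real nonzero root. A common root of numerator and denominator would also be a root of
  numerator \<open>- l\<^sub>2 \<cdot>\<close> denominator, which is a multiple of \<open>\<epsilon> (\<epsilon> + \<gamma>)\<close>, and of
  numerator \<open>- l\<^sub>1 \<cdot>\<close> denominator, which is a multiple of \<open>1 + \<gamma> \<epsilon>\<close>; this would give \<open>\<gamma>\<^sup>2 = 1\<close>.
\<close>

lemma lambda_fun_nontrivial_zero:
  assumes m: "m1 * m2 > 0" and l: "l1 * l2 < 0" and \<gamma>: "\<gamma>\<^sup>2 < 1"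
  shows "\<exists>\<epsilon>. \<epsilon> \<noteq> 0 \<and> coarse_denominator m1 m2 \<epsilon> \<gamma> \<noteq> 0 \<and> lambda_fun l1 l2 m1 m2 \<epsilon> \<gamma> = 0"
proof -
  define a b c where "a = l1 * m2" and "b = \<gamma> * (l1 * m2 + l2 * m1)" and "c = l2 * m1"
  have nz: "m1 \<noteq> 0" "m2 \<noteq> 0" "l1 \<noteq> 0" "l2 \<noteq> 0" using m l by auto
  have "a * c = (l1 * l2) * (m1 * m2)" by (simp add: a_def c_def)
  then have "a * c < 0" using m l by (simp add: mult_neg_pos)
  then have "discrim a b c \<ge> 0"
    using zero_le_power2[of b] unfolding discrim_def mult.assoc by linarith
  moreover have "a \<noteq> 0" using nz by (simp add: a_def)
  ultimately obtain \<epsilon> where root: "a * \<epsilon>\<^sup>2 + b * \<epsilon> + c = 0"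
    using discriminant_nonneg by blast
  have "\<epsilon> \<noteq> 0" using root nz by (auto simp: c_def)
  moreover have "coarse_denominator m1 m2 \<epsilon> \<gamma> \<noteq> 0"
  proof
    assume D: "coarse_denominator m1 m2 \<epsilon> \<gamma> = 0"
    have "(l1 - l2) * m2 * (\<epsilon> * (\<epsilon> + \<gamma>)) = a * \<epsilon>\<^sup>2 + b * \<epsilon> + c - l2 * coarse_denominator m1 m2 \<epsilon> \<gamma>"
      by (simp add: a_def b_def c_def coarse_denominator_def algebra_simps power2_eq_square)
    moreover have "(l2 - l1) * m1 * (1 + \<gamma> * \<epsilon>) = a * \<epsilon>\<^sup>2 + b * \<epsilon> + c - l1 * coarse_denominator m1 m2 \<epsilon> \<gamma>"
      by (simp add: a_def b_def c_def coarse_denominator_def algebra_simps power2_eq_square)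
    moreover have "l1 \<noteq> l2" using l by (auto simp: mult_less_0_iff)
    ultimately have "\<epsilon> = - \<gamma>" and "1 + \<gamma> * \<epsilon> = 0"
      using root D nz \<open>\<epsilon> \<noteq> 0\<close> by auto
    then show False using \<gamma> by (simp add: power2_eq_square)
  qed
  moreover have "lambda_fun l1 l2 m1 m2 \<epsilon> \<gamma> = 0"
    using root by (simp add: lambda_fun_def a_def b_def c_def)
  ultimately show ?thesis by blast
qed

text \<open>
  The derivative of \<open>\<lambda>(\<epsilon>,\<gamma>)\<close> at \<open>\<epsilon> = 0\<close> is \<open>\<gamma> m\<^sub>2 (l\<^sub>1 - l\<^sub>2) / m\<^sub>1 \<noteq> 0\<close>. Differentiating the square
  instead tracks the modulus whatever the signs of \<open>l\<^sub>1\<close> and \<open>l\<^sub>2\<close>.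
\<close>

lemma lambda_fun_decrease_near_zero:
  assumes nz: "m1 \<noteq> 0" "m2 \<noteq> 0" "l1 \<noteq> l2" "l2 \<noteq> 0" "\<gamma> \<noteq> 0"
  shows "\<exists>\<epsilon>. \<epsilon> \<noteq> 0 \<and> coarse_denominator m1 m2 \<epsilon> \<gamma> \<noteq> 0 \<and> \<bar>lambda_fun l1 l2 m1 m2 \<epsilon> \<gamma>\<bar> < \<bar>l2\<bar>"
proof -
  define sq where "sq \<epsilon> = (lambda_fun l1 l2 m1 m2 \<epsilon> \<gamma>)\<^sup>2" for \<epsilon>
  define s where "s = 2 * l2 * (\<gamma> * m2 * (l1 - l2) / m1)"
  have "s \<noteq> 0" using nz by (simp add: s_def)
  have "(sq has_real_derivative s) (at 0)"
    unfolding sq_def lambda_fun_def s_def using nz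
    by (auto intro!: derivative_eq_intros simp: field_simps power2_eq_square)
  have "isCont (\<lambda>\<epsilon>. coarse_denominator m1 m2 \<epsilon> \<gamma>) 0"
    unfolding coarse_denominator_def by (intro continuous_intros)
  moreover have "coarse_denominator m1 m2 0 \<gamma> \<noteq> 0" using nz by (simp add: coarse_denominator_def)
  ultimately obtain r where r: "r > 0" "\<And>\<epsilon>. \<bar>\<epsilon>\<bar> < r \<Longrightarrow> coarse_denominator m1 m2 \<epsilon> \<gamma> \<noteq> 0"
    using continuous_at_avoid[of 0 "\<lambda>\<epsilon>. coarse_denominator m1 m2 \<epsilon> \<gamma>" 0]
    by (auto simp: dist_real_def)
  obtain d where d: "d > 0" "\<And>h. 0 < h \<Longrightarrow> h < d \<Longrightarrow> sq (- (sgn s) * h) < sq 0"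
  proof (cases "s > 0")
    case True
    from DERIV_pos_inc_left[OF \<open>(sq has_real_derivative s) (at 0)\<close> this] that True show ?thesis by auto
  next
    case False
    with \<open>s \<noteq> 0\<close> have "s < 0" by simp
    from DERIV_neg_dec_right[OF \<open>(sq has_real_derivative s) (at 0)\<close> this] that \<open>s < 0\<close> show ?thesis by auto
  qed
  \<comment> \<open>A step against the sign of the derivative, short enough for both neighbourhoods of \<open>0\<close>.\<close>
  define \<epsilon> where "\<epsilon> = - (sgn s) * (min r d / 2)"
  have "\<bar>\<epsilon>\<bar> = min r d / 2" using \<open>s \<noteq> 0\<close> r(1) d(1) by (simp add: \<epsilon>_def abs_mult abs_sgn_eq)
  then have "\<epsilon> \<noteq> 0" and "coarse_denominator m1 m2 \<epsilon> \<gamma> \<noteq> 0" using r d(1) by auto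
  moreover have "sq \<epsilon> < sq 0" unfolding \<epsilon>_def using r(1) d(1) by (intro d(2)) auto
  then have "\<bar>lambda_fun l1 l2 m1 m2 \<epsilon> \<gamma>\<bar> < \<bar>l2\<bar>"
    using nz(1) power2_less_imp_less[of "\<bar>lambda_fun l1 l2 m1 m2 \<epsilon> \<gamma>\<bar>" "\<bar>l2\<bar>"]
    by (simp add: sq_def lambda_fun_at_zero)
  ultimately show ?thesis by blast
qed

text \<open>
  For \<open>\<epsilon> \<noteq> 0\<close> the denominator is a nonconstant affine function of \<open>\<gamma>\<close> with zero \<open>\<gamma>\<^sup>*\<close>, where the
  numerator equals \<open>m\<^sub>1 m\<^sub>2 (l\<^sub>1 - l\<^sub>2) (\<epsilon>\<^sup>2 - 1) / (m\<^sub>1 + m\<^sub>2)\<close>. The conditions \<open>\<epsilon>\<^sup>2 \<noteq> 1\<close> and \<open>l\<^sub>1 \<noteq> l\<^sub>2\<close> are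
  exactly what keeps the singularity from being removable.
\<close>

lemma lambda_fun_pole:
  assumes m: "m1 * m2 > 0" and nz: "\<epsilon> \<noteq> 0" "\<epsilon>\<^sup>2 \<noteq> 1" "l1 \<noteq> l2"
  shows "filterlim (lambda_fun l1 l2 m1 m2 \<epsilon>) at_infinity (at (gamma_star m1 m2 \<epsilon>))"
proof -
  define gs where "gs = gamma_star m1 m2 \<epsilon>"
  define num where "num g = l1 * m2 * \<epsilon>\<^sup>2 + g * (l1 * m2 + l2 * m1) * \<epsilon> + l2 * m1" for g
  have sum_nz: "m1 + m2 \<noteq> 0" and m_nz: "m1 \<noteq> 0" "m2 \<noteq> 0"
    using m by (auto simp: zero_less_mult_iff)
  have gs: "gs * (m1 + m2) * \<epsilon> = - (m2 * \<epsilon>\<^sup>2 + m1)"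
  proof -
    have "gs * (\<epsilon> * (m1 + m2)) = - (\<epsilon>\<^sup>2 * m2 + m1)"
      using nz(1) sum_nz by (simp add: gs_def gamma_star_def)
    then show ?thesis by (simp add: algebra_simps)
  qed
  have den: "coarse_denominator m1 m2 \<epsilon> g = (g - gs) * ((m1 + m2) * \<epsilon>)" for g
    using gs by (simp add: coarse_denominator_def algebra_simps)
  have "(m1 + m2) * num gs = m1 * m2 * (l1 - l2) * (\<epsilon>\<^sup>2 - 1)"
  proof -
    have "(m1 + m2) * num gs = (m1 + m2) * (l1 * m2 * \<epsilon>\<^sup>2 + l2 * m1) +
        (gs * (m1 + m2) * \<epsilon>) * (l1 * m2 + l2 * m1)"
      by (simp add: num_def algebra_simps)
    also have "\<dots> = m1 * m2 * (l1 - l2) * (\<epsilon>\<^sup>2 - 1)"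
      unfolding gs by (simp add: algebra_simps)
    finally show ?thesis .
  qed
  then have num_nz: "num gs \<noteq> 0" using nz m_nz sum_nz by auto
  have "(num \<longlongrightarrow> num gs) (at gs)"
    unfolding num_def by (intro tendsto_intros)
  moreover have "filterlim (\<lambda>g. (g - gs) * ((m1 + m2) * \<epsilon>)) (at 0) (at gs)"
    unfolding filterlim_at
  proof
    show "((\<lambda>g. (g - gs) * ((m1 + m2) * \<epsilon>)) \<longlongrightarrow> 0) (at gs)"
      by (auto intro!: tendsto_eq_intros)
    show "\<forall>\<^sub>F g in at gs. (g - gs) * ((m1 + m2) * \<epsilon>) \<in> UNIV \<and> (g - gs) * ((m1 + m2) * \<epsilon>) \<noteq> 0"
      using nz(1) sum_nz by (auto simp: eventually_at_filter)
  qed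
  ultimately have "filterlim (\<lambda>g. num g / ((g - gs) * ((m1 + m2) * \<epsilon>))) at_infinity (at gs)"
    by (rule filterlim_divide_at_infinity) (rule num_nz)
  moreover have "lambda_fun l1 l2 m1 m2 \<epsilon> = (\<lambda>g. num g / ((g - gs) * ((m1 + m2) * \<epsilon>)))"
    by (rule ext) (simp add: lambda_fun_def num_def flip: den coarse_denominator_def)
  ultimately show ?thesis by (simp add: gs_def)
qed

lemma pole_neighbourhood_avoids_unit_interval:
  fixes f :: "real \<Rightarrow> real"
  assumes "filterlim f at_infinity (at a)"
  shows "\<exists>I. open I \<and> a \<in> I \<and> (\<forall>x\<in>I - {a}. f x \<notin> {-1<..<1})"
proof -
  have "\<forall>\<^sub>F x in at a. 1 \<le> norm (f x)"
    using assms filterlim_at_infinity[of 0 f "at a"] by simp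
  then obtain I where "open I" "a \<in> I" "\<forall>x\<in>I. x \<noteq> a \<longrightarrow> 1 \<le> norm (f x)"
    by (auto simp: eventually_at_topological)
  then show ?thesis by (intro exI[of _ I]) fastforce
qed

section \<open>The two-level operator in the eigenbasis\<close>

locale two_level_eigenbasis =
  fixes N :: nat and ip :: "complex vec \<Rightarrow> complex vec \<Rightarrow> complex"
    and A G :: "complex mat" and psi :: "nat \<Rightarrow> complex vec" and lam mu :: "nat \<Rightarrow> complex"
  assumes N: "2 \<le> N"
    and inner: "complex_inner_product N ip"
    and A: "A \<in> carrier_mat N N" and G: "G \<in> carrier_mat N N"
    and indep: "lin_indep_family N psi"
    and eigA: "\<And>k. k \<in> {1..N} \<Longrightarrow> eigenvector A (psi k) (mu k)"
    and eigG: "\<And>k. k \<in> {1..N} \<Longrightarrow> eigenvector G (psi k) (lam k)"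
begin

lemma psi_image: "psi ` {1..N} \<subseteq> carrier_vec N"
  using indep by (simp add: lin_indep_family_def)

lemma psi_carrier: "k \<in> {1..N} \<Longrightarrow> psi k \<in> carrier_vec N"
  using psi_image by blast

lemma psi_12_carrier: "psi 1 \<in> carrier_vec N" "psi 2 \<in> carrier_vec N"
  using N psi_carrier[of 1] psi_carrier[of 2] by simp_all

lemma A_psi: "k \<in> {1..N} \<Longrightarrow> A *\<^sub>v psi k = mu k \<cdot>\<^sub>v psi k"
  using eigA by (simp add: eigenvector_def)

lemma G_psi: "k \<in> {1..N} \<Longrightarrow> G *\<^sub>v psi k = lam k \<cdot>\<^sub>v psi k"
  using eigG by (simp add: eigenvector_def)

lemma coarse_vec_carrier: "coarse_vec psi \<epsilon> \<in> carrier_vec N"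
  using psi_12_carrier by (simp add: coarse_vec_def)

lemma ip_add_right:
  "\<lbrakk>f \<in> carrier_vec N; g \<in> carrier_vec N; h \<in> carrier_vec N\<rbrakk> \<Longrightarrow> ip f (g + h) = ip f g + ip f h"
  using inner unfolding complex_inner_product_def by blast

lemma ip_smult_right:
  "\<lbrakk>f \<in> carrier_vec N; g \<in> carrier_vec N\<rbrakk> \<Longrightarrow> ip f (c \<cdot>\<^sub>v g) = c * ip f g"
  using inner unfolding complex_inner_product_def by blast

lemma ip_cnj: "\<lbrakk>f \<in> carrier_vec N; g \<in> carrier_vec N\<rbrakk> \<Longrightarrow> ip g f = cnj (ip f g)"
  using inner unfolding complex_inner_product_def by blast

lemma ip_coarse_vec_left:
  assumes "f \<in> carrier_vec N"
  shows "ip (coarse_vec psi \<epsilon>) f = ip (psi 1) f + of_real \<epsilon> * ip (psi 2) f"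
proof -
  have "ip (coarse_vec psi \<epsilon>) f = cnj (ip f (psi 1 + of_real \<epsilon> \<cdot>\<^sub>v psi 2))"
    using ip_cnj[OF assms coarse_vec_carrier] by (simp add: coarse_vec_def)
  also have "\<dots> = cnj (ip f (psi 1)) + of_real \<epsilon> * cnj (ip f (psi 2))"
    using assms psi_12_carrier by (simp add: ip_add_right ip_smult_right)
  finally show ?thesis
    using ip_cnj[OF assms psi_12_carrier(1)] ip_cnj[OF assms psi_12_carrier(2)] by simp
qed

lemma coarse_matrix_eq:
  "coarse_matrix ip A (coarse_vec psi \<epsilon>) =
    mu 1 * ip (coarse_vec psi \<epsilon>) (psi 1) + of_real \<epsilon> * mu 2 * ip (coarse_vec psi \<epsilon>) (psi 2)"
proof -
  have "A *\<^sub>v coarse_vec psi \<epsilon> = mu 1 \<cdot>\<^sub>v psi 1 + (of_real \<epsilon> * mu 2) \<cdot>\<^sub>v psi 2"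
    using A psi_12_carrier A_psi[of 1] A_psi[of 2] N
    by (simp add: coarse_vec_def mult_add_distrib_mat_vec[of A N N] mult_mat_vec[of A N N]
        smult_smult_assoc)
  then show ?thesis
    using psi_12_carrier coarse_vec_carrier[of \<epsilon>]
    by (simp add: coarse_matrix_def restriction_def prolongation_def ip_add_right ip_smult_right)
qed

text \<open>
  The multiple of \<open>p\<close> that the coarse correction subtracts from \<open>G \<psi>\<^sub>j\<close>.
\<close>

definition correction_coeff :: "real \<Rightarrow> nat \<Rightarrow> complex" where
  "correction_coeff \<epsilon> j =
    lam j * mu j * ip (coarse_vec psi \<epsilon>) (psi j) / coarse_matrix ip A (coarse_vec psi \<epsilon>)"

lemma two_level_op_psi:
  assumes j: "j \<in> {1..N}"
  shows "two_level_op ip A G (coarse_vec psi \<epsilon>) (psi j) =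
    lam j \<cdot>\<^sub>v psi j + (- correction_coeff \<epsilon> j \<cdot>\<^sub>v psi 1 + (- correction_coeff \<epsilon> j * of_real \<epsilon>) \<cdot>\<^sub>v psi 2)"
proof -
  note carrier = psi_carrier[OF j] psi_12_carrier coarse_vec_carrier[of \<epsilon>]
  have AG: "A *\<^sub>v (G *\<^sub>v psi j) = (lam j * mu j) \<cdot>\<^sub>v psi j"
    using A carrier by (simp add: G_psi[OF j] A_psi[OF j] mult_mat_vec[of A N N] smult_smult_assoc)
  have "inverse (coarse_matrix ip A (coarse_vec psi \<epsilon>)) *
      restriction ip (coarse_vec psi \<epsilon>) (A *\<^sub>v (G *\<^sub>v psi j)) = correction_coeff \<epsilon> j"
    using carrier by (simp add: AG restriction_def ip_smult_right correction_coeff_def field_simps)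
  then have "two_level_op ip A G (coarse_vec psi \<epsilon>) (psi j) =
      lam j \<cdot>\<^sub>v psi j - correction_coeff \<epsilon> j \<cdot>\<^sub>v coarse_vec psi \<epsilon>"
    by (simp add: two_level_op_def prolongation_def G_psi[OF j])
  then show ?thesis
    using carrier by (intro eq_vecI) (auto simp: coarse_vec_def algebra_simps)
qed

text \<open>
  Matrix indices are shifted by one against the indices of the \<open>\<psi>\<^sub>k\<close>; columns \<open>0\<close> and \<open>1\<close> hold the
  coefficients of \<open>\<psi>\<^sub>1\<close> and \<open>\<psi>\<^sub>2\<close>, the only ones that the coarse correction touches.
\<close>

lemma two_level_matrix_eq:
  "two_level_matrix N ip A G psi \<epsilon> = mat N N (\<lambda>(i,l). (if l = i then lam (Suc i) else 0)
    + (if l = 0 then - correction_coeff \<epsilon> (Suc i) else 0)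
    + (if l = 1 then - correction_coeff \<epsilon> (Suc i) * of_real \<epsilon> else 0))" (is "_ = ?M")
  unfolding two_level_matrix_def
proof (rule matrix_rep_eqI[OF indep])
  fix j assume j: "j \<in> {1..N}"
  have "finsum_vec TYPE(complex) N (\<lambda>l. ?M $$ (j - 1, l - 1) \<cdot>\<^sub>v psi l) {1..N} =
      finsum_vec TYPE(complex) N (\<lambda>l. ((if l = j then lam j else 0)
        + (if l = 1 then - correction_coeff \<epsilon> j else 0)
        + (if l = 2 then - correction_coeff \<epsilon> j * of_real \<epsilon> else 0)) \<cdot>\<^sub>v psi l) {1..N}"
    (is "finsum_vec _ _ ?f _ = finsum_vec _ _ ?g _")
  proof -
    have "?f l = ?g l" if l: "l \<in> {1..N}" for l
    proof -
      obtain i k where "j = Suc i" "l = Suc k" "i < N" "k < N"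
        using l j by (cases j; cases l) auto
      then show ?thesis by (simp add: numeral_2_eq_2)
    qed
    then show ?thesis
      unfolding finsum_vec_def
      by (intro comm_monoid.finprod_cong[OF comm_group.axioms(1)[OF comm_group_vec]])
        (use psi_carrier in \<open>auto simp: monoid_vec_def simp_implies_def\<close>)
  qed
  then show "two_level_op ip A G (coarse_vec psi \<epsilon>) (psi j) =
      finsum_vec TYPE(complex) N (\<lambda>l. ?M $$ (j - 1, l - 1) \<cdot>\<^sub>v psi l) {1..N}"
    using two_level_op_psi[OF j] finsum_vec_three_terms[OF psi_image N j] by simp
qed simp

text \<open>
  With \<open>D = A\<^sub>c = \<mu>\<^sub>1 \<langle>p,\<psi>\<^sub>1\<rangle> + \<epsilon> \<mu>\<^sub>2 \<langle>p,\<psi>\<^sub>2\<rangle>\<close>, the determinant of the leading block is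
  \<open>\<lambda>\<^sub>1 \<lambda>\<^sub>2 (1 - D / D) = 0\<close>, and in its trace each \<open>\<lambda>\<^sub>k\<close> keeps the summand of \<open>D\<close> that belongs to the
  other eigenvector.
\<close>

lemma spectrum_two_level_matrix:
  fixes \<epsilon> :: real
  defines "p \<equiv> coarse_vec psi \<epsilon>"
  assumes adm: "admissible ip A psi \<epsilon>"
  shows "spectrum (two_level_matrix N ip A G psi \<epsilon>) =
    {0, (lam 1 * of_real \<epsilon> * mu 2 * ip p (psi 2) + lam 2 * mu 1 * ip p (psi 1)) / coarse_matrix ip A p}
    \<union> lam ` {3..N}"
proof -
  define M where "M = two_level_matrix N ip A G psi \<epsilon>"
  define D where "D = coarse_matrix ip A p"
  have D0: "D \<noteq> 0" using adm by (simp add: admissible_def D_def p_def)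
  have D: "D = mu 1 * ip p (psi 1) + of_real \<epsilon> * mu 2 * ip p (psi 2)"
    using coarse_matrix_eq by (simp add: D_def p_def)
  have c: "correction_coeff \<epsilon> j = lam j * mu j * ip p (psi j) / D" for j
    by (simp add: correction_coeff_def D_def p_def)
  have entries: "M $$ (0,0) = lam 1 - correction_coeff \<epsilon> 1"
    "M $$ (0,1) = - correction_coeff \<epsilon> 1 * of_real \<epsilon>"
    "M $$ (1,0) = - correction_coeff \<epsilon> 2"
    "M $$ (1,1) = lam 2 - correction_coeff \<epsilon> 2 * of_real \<epsilon>"
    using N by (simp_all add: M_def two_level_matrix_eq numeral_2_eq_2)
  have "M $$ (0,0) * M $$ (1,1) - M $$ (0,1) * M $$ (1,0) =
      lam 1 * lam 2 * (D - (mu 1 * ip p (psi 1) + of_real \<epsilon> * mu 2 * ip p (psi 2))) / D"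
    unfolding entries c using D0 by (simp add: field_simps)
  then have singular: "M $$ (0,0) * M $$ (1,1) = M $$ (0,1) * M $$ (1,0)"
    using D by simp
  have "M $$ (0,0) + M $$ (1,1) =
      (lam 1 * (D - mu 1 * ip p (psi 1)) + lam 2 * (D - of_real \<epsilon> * mu 2 * ip p (psi 2))) / D"
    unfolding entries c using D0 by (simp add: field_simps)
  also have "\<dots> = (lam 1 * of_real \<epsilon> * mu 2 * ip p (psi 2) + lam 2 * mu 1 * ip p (psi 1)) / D"
    by (simp add: D algebra_simps)
  finally have trace: "M $$ (0,0) + M $$ (1,1) =
    (lam 1 * of_real \<epsilon> * mu 2 * ip p (psi 2) + lam 2 * mu 1 * ip p (psi 1)) / D" .
  have "spectrum M = {0, M $$ (0,0) + M $$ (1,1)} \<union> (\<lambda>j. M $$ (j,j)) ` {2..<N}"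
    by (rule spectrum_singular_block_above_diagonal[OF _ N _ singular])
      (auto simp: M_def two_level_matrix_eq)
  also have "(\<lambda>j. M $$ (j,j)) ` {2..<N} = (\<lambda>j. lam (Suc j)) ` {2..<N}"
    by (intro image_cong) (auto simp: M_def two_level_matrix_eq)
  also have "\<dots> = lam ` {3..N}"
    by (simp add: image_Suc_atLeastLessThan atLeastLessThanSuc_atLeastAtMost flip: image_image[of lam Suc])
  finally show ?thesis unfolding trace unfolding M_def D_def .
qed

text \<open>
  The vector \<open>h = \<psi>\<^sub>1 - \<gamma> \<psi>\<^sub>2\<close> is nonzero by linear independence, and \<open>\<langle>h,h\<rangle> = 1 - \<gamma>\<^sup>2\<close>. It is the
  coarse vector for \<open>\<epsilon> = - \<gamma>\<close>, so the expansion of inner products with \<open>p\<close> applies to it.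
\<close>

lemma unit_vectors_ip_square_less_1:
  assumes unit: "ip (psi 1) (psi 1) = 1" "ip (psi 2) (psi 2) = 1"
    and \<gamma>: "ip (psi 1) (psi 2) = of_real \<gamma>"
  shows "\<gamma>\<^sup>2 < 1"
proof -
  define h where "h = coarse_vec psi (- \<gamma>)"
  have h: "h \<in> carrier_vec N" by (simp add: h_def coarse_vec_carrier)
  have ip21: "ip (psi 2) (psi 1) = of_real \<gamma>"
    using ip_cnj[OF psi_12_carrier] \<gamma> by simp
  have "ip h h = ip h (psi 1) + of_real (- \<gamma>) * ip h (psi 2)"
    using psi_12_carrier h ip_add_right[of h "psi 1" "of_real (- \<gamma>) \<cdot>\<^sub>v psi 2"]
      ip_smult_right[of h "psi 2" "of_real (- \<gamma>)"]
    by (simp add: coarse_vec_def[of psi "- \<gamma>", folded h_def] del: One_nat_def)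
  also have "\<dots> = of_real (1 - \<gamma>\<^sup>2)"
    using psi_12_carrier unit \<gamma> ip21 by (simp add: h_def ip_coarse_vec_left power2_eq_square)
  finally have "Re (ip h h) = 1 - \<gamma>\<^sup>2" by simp
  moreover have "h \<noteq> 0\<^sub>v N"
  proof
    assume "h = 0\<^sub>v N"
    have expand: "finsum_vec TYPE(complex) N (\<lambda>l. ((if l = 1 then 0 else 0) +
        (if l = 1 then x else 0) + (if l = 2 then y else 0)) \<cdot>\<^sub>v psi l) {1..N} =
        x \<cdot>\<^sub>v psi 1 + y \<cdot>\<^sub>v psi 2" for x y
    proof -
      have "0 \<cdot>\<^sub>v psi 1 + (x \<cdot>\<^sub>v psi 1 + y \<cdot>\<^sub>v psi 2) = x \<cdot>\<^sub>v psi 1 + y \<cdot>\<^sub>v psi 2"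
        using psi_12_carrier by (intro eq_vecI) auto
      then show ?thesis
        using N finsum_vec_three_terms[OF psi_image N, of 1 0 x y] by simp
    qed
    have "1 \<cdot>\<^sub>v psi 1 + of_real (- \<gamma>) \<cdot>\<^sub>v psi 2 = 0\<^sub>v N"
      using \<open>h = 0\<^sub>v N\<close> psi_12_carrier by (simp add: h_def coarse_vec_def)
    also have "\<dots> = 0 \<cdot>\<^sub>v psi 1 + 0 \<cdot>\<^sub>v psi 2"
      using psi_12_carrier by (intro eq_vecI) auto
    finally have "1 \<cdot>\<^sub>v psi 1 + of_real (- \<gamma>) \<cdot>\<^sub>v psi 2 = 0 \<cdot>\<^sub>v psi 1 + 0 \<cdot>\<^sub>v psi 2" .
    then have "finsum_vec TYPE(complex) N (\<lambda>l. ((if l = 1 then 0 else 0) +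
        (if l = 1 then 1 else 0) + (if l = 2 then of_real (- \<gamma>) else 0)) \<cdot>\<^sub>v psi l) {1..N} =
      finsum_vec TYPE(complex) N (\<lambda>l. ((if l = 1 then 0 else 0) +
        (if l = 1 then 0 else 0) + (if l = 2 then 0 else 0)) \<cdot>\<^sub>v psi l) {1..N}"
      by (simp only: expand)
    from lin_indep_family_coeffs_unique[OF indep this, of 1] N show False by simp
  qed
  then have "0 < Re (ip h h)"
    using inner h unfolding complex_inner_product_def by blast
  ultimately show ?thesis by simp
qed

lemma coarse_matrix_real:
  assumes unit: "ip (psi 1) (psi 1) = 1" "ip (psi 2) (psi 2) = 1"
    and \<gamma>: "ip (psi 1) (psi 2) = of_real \<gamma>" and mu: "mu 1 = of_real m1" "mu 2 = of_real m2"
  shows "coarse_matrix ip A (coarse_vec psi \<epsilon>) = of_real (coarse_denominator m1 m2 \<epsilon> \<gamma>)"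
  using ip_cnj[OF psi_12_carrier] psi_12_carrier
  by (simp add: coarse_matrix_eq ip_coarse_vec_left assms coarse_denominator_def
      algebra_simps power2_eq_square del: One_nat_def)

text \<open>
  For real data and unit vectors, \<open>\<langle>p,\<psi>\<^sub>1\<rangle> = 1 + \<epsilon> \<gamma>\<close> and \<open>\<langle>p,\<psi>\<^sub>2\<rangle> = \<gamma> + \<epsilon>\<close>, which turns the trace of
  the leading block into \<open>\<lambda>(\<epsilon>,\<gamma>)\<close>.
\<close>

lemma spectral_radius_two_level_matrix:
  assumes N3: "3 \<le> N"
    and unit: "ip (psi 1) (psi 1) = 1" "ip (psi 2) (psi 2) = 1"
    and \<gamma>: "ip (psi 1) (psi 2) = of_real \<gamma>"
    and mu: "mu 1 = of_real m1" "mu 2 = of_real m2"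
    and lam: "lam 1 = of_real l1" "lam 2 = of_real l2"
    and dominated: "\<And>k. k \<in> {3..N} \<Longrightarrow> cmod (lam k) \<le> cmod (lam 3)"
    and adm: "admissible ip A psi \<epsilon>"
  shows "spectral_radius (two_level_matrix N ip A G psi \<epsilon>) =
    max \<bar>lambda_fun l1 l2 m1 m2 \<epsilon> \<gamma>\<bar> (cmod (lam 3))"
proof -
  define p where "p = coarse_vec psi \<epsilon>"
  have ip21: "ip (psi 2) (psi 1) = of_real \<gamma>"
    using ip_cnj[OF psi_12_carrier] \<gamma> by simp
  have "(lam 1 * of_real \<epsilon> * mu 2 * ip p (psi 2) + lam 2 * mu 1 * ip p (psi 1)) / coarse_matrix ip A p
      = of_real (lambda_fun l1 l2 m1 m2 \<epsilon> \<gamma>)"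
    using psi_12_carrier unfolding p_def
    by (simp add: coarse_matrix_real[OF unit \<gamma> mu] ip_coarse_vec_left unit \<gamma> ip21 mu lam
        lambda_fun_def coarse_denominator_def algebra_simps power2_eq_square del: One_nat_def)
  then have spec: "spectrum (two_level_matrix N ip A G psi \<epsilon>) =
      {0, of_real (lambda_fun l1 l2 m1 m2 \<epsilon> \<gamma>)} \<union> lam ` {3..N}"
    using spectrum_two_level_matrix[OF adm] by (simp add: p_def)
  have "Max (cmod ` spectrum (two_level_matrix N ip A G psi \<epsilon>)) =
      max \<bar>lambda_fun l1 l2 m1 m2 \<epsilon> \<gamma>\<bar> (cmod (lam 3))"
    unfolding spec
  proof (rule Max_eqI)
    show "max \<bar>lambda_fun l1 l2 m1 m2 \<epsilon> \<gamma>\<bar> (cmod (lam 3)) \<in>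
        cmod ` ({0, of_real (lambda_fun l1 l2 m1 m2 \<epsilon> \<gamma>)} \<union> lam ` {3..N})"
      using N3 by (auto simp: max_def)
  qed (use dominated in \<open>auto simp: le_max_iff_disj\<close>)
  then show ?thesis by (simp add: spectral_radius_def)
qed

end

section \<open>Optimal coarse spaces\<close>

theorem theorem4p6:
  fixes N :: nat
    and ip :: "complex vec \<Rightarrow> complex vec \<Rightarrow> complex"
    and A G :: "complex mat"
    and psi :: "nat \<Rightarrow> complex vec"
    and lam mu :: "nat \<Rightarrow> complex"
    and l1 l2 m1 m2 \<gamma> :: real
  defines "rho \<equiv> \<lambda>\<epsilon>. spectral_radius (two_level_matrix N ip A G psi \<epsilon>)"
    and "adm \<equiv> admissible ip A psi"
    and "L \<equiv> lambda_fun l1 l2 m1 m2"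
  assumes "N \<ge> 3"
    and "complex_inner_product N ip"
    and "A \<in> carrier_mat N N" and "invertible_mat A"
    and "G \<in> carrier_mat N N"
    and "lin_indep_family N psi"
    and "\<And>k. k \<in> {1..N} \<Longrightarrow> eigenvector A (psi k) (mu k)"
    and "\<And>k. k \<in> {1..N} \<Longrightarrow> eigenvector G (psi k) (lam k)"
    and "\<And>k. k \<in> {1..N} \<Longrightarrow> 0 < cmod (lam k) \<and> cmod (lam k) < 1"
    and "\<And>k. k \<in> {2..N} \<Longrightarrow> cmod (lam k) \<le> cmod (lam (k - 1))"
    and "0 < cmod (lam 3)" and "cmod (lam 3) < cmod (lam 2)" and "cmod (lam 2) \<le> cmod (lam 1)"
    and "induced_norm ip (psi 1) = 1" and "induced_norm ip (psi 2) = 1"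
    and "lam 1 = complex_of_real l1" and "lam 2 = complex_of_real l2"
    and "mu 1 = complex_of_real m1" and "mu 2 = complex_of_real m2"
    and "m1 * m2 > 0"
    and "ip (psi 1) (psi 2) = complex_of_real \<gamma>" and "\<gamma> \<in> {-1..1}"
  shows
    "(\<forall>\<epsilon>. adm \<epsilon> \<longrightarrow> rho \<epsilon> = max \<bar>L \<epsilon> \<gamma>\<bar> (cmod (lam 3)))
     \<and>
     (\<gamma> = 0 \<longrightarrow> (l1 > l2 \<and> l2 > 0) \<or> (0 > l2 \<and> l2 > l1) \<longrightarrow>
        is_arg_min rho adm 0)
     \<and>
     (\<gamma> = 0 \<longrightarrow> (l2 > 0 \<and> 0 > l1) \<or> (l1 > 0 \<and> 0 > l2) \<longrightarrow>
        (\<exists>\<epsilon>'. \<epsilon>' \<noteq> 0 \<and> is_arg_min rho adm \<epsilon>' \<and> rho \<epsilon>' = cmod (lam 3) \<and> adm 0 \<and> rho \<epsilon>' < rho 0))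
     \<and>
     (\<gamma> \<noteq> 0 \<longrightarrow> (l1 > l2 \<and> l2 > 0) \<or> (0 > l2 \<and> l2 > l1) \<longrightarrow>
        (\<exists>\<epsilon>'. \<epsilon>' \<noteq> 0 \<and> adm \<epsilon>' \<and> \<bar>L \<epsilon>' \<gamma>\<bar> < \<bar>l2\<bar> \<and>
           rho \<epsilon>' = max \<bar>L \<epsilon>' \<gamma>\<bar> (cmod (lam 3)) \<and> adm 0 \<and> rho \<epsilon>' < rho 0))
     \<and>
     (\<gamma> \<noteq> 0 \<longrightarrow> (l2 > 0 \<and> 0 > l1) \<or> (l1 > 0 \<and> 0 > l2) \<longrightarrow>
        (\<exists>\<epsilon>'. \<epsilon>' \<noteq> 0 \<and> is_arg_min rho adm \<epsilon>' \<and> rho \<epsilon>' = cmod (lam 3) \<and> adm 0 \<and> rho \<epsilon>' < rho 0))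
     \<and>
     (\<forall>\<epsilon>. \<epsilon> \<noteq> 0 \<longrightarrow> \<epsilon>\<^sup>2 \<noteq> - ((l2 * m1) * (m1 + m2) / (l1 * m2\<^sup>2 + m1\<^sup>2 * l2)) \<longrightarrow>
        \<epsilon>\<^sup>2 \<noteq> 1 \<longrightarrow> l1 \<noteq> l2 \<longrightarrow>
        filterlim (\<lambda>g. L \<epsilon> g) at_infinity (at (gamma_star m1 m2 \<epsilon>)) \<and>
        (\<exists>I. open I \<and> gamma_star m1 m2 \<epsilon> \<in> I \<and>
           (\<forall>g\<in>I - {gamma_star m1 m2 \<epsilon>}. L \<epsilon> g \<notin> {-1<..<1})))"
proof -
  have N2: "2 \<le> N" using \<open>N \<ge> 3\<close> by simp
  interpret two_level_eigenbasis N ip A G psi lam mu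
    by (unfold_locales; fact)
  have unit_of_norm: "ip f f = 1" if f: "f \<in> carrier_vec N" and "induced_norm ip f = 1" for f
    using that(2) ip_cnj[OF f f] by (simp add: induced_norm_def complex_eq_iff)
  have unit: "ip (psi 1) (psi 1) = 1" "ip (psi 2) (psi 2) = 1"
    using unit_of_norm psi_12_carrier \<open>induced_norm ip (psi 1) = 1\<close> \<open>induced_norm ip (psi 2) = 1\<close>
    by simp_all
  note mu = \<open>mu 1 = complex_of_real m1\<close> \<open>mu 2 = complex_of_real m2\<close>
  note lam = \<open>lam 1 = complex_of_real l1\<close> \<open>lam 2 = complex_of_real l2\<close>
  note ip12 = \<open>ip (psi 1) (psi 2) = complex_of_real \<gamma>\<close>
  have m: "m1 * m2 > 0" "m1 \<noteq> 0" "m2 \<noteq> 0" using \<open>m1 * m2 > 0\<close> by auto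
  have \<gamma>: "\<gamma>\<^sup>2 < 1" by (rule unit_vectors_ip_square_less_1[OF unit ip12])
  have l3: "cmod (lam 3) < \<bar>l2\<bar>" using \<open>cmod (lam 3) < cmod (lam 2)\<close> lam by simp
  have dominated: "cmod (lam k) \<le> cmod (lam 3)" if "k \<in> {3..N}" for k
  proof -
    from that have "3 \<le> k" by simp
    then have "k \<le> N \<longrightarrow> cmod (lam k) \<le> cmod (lam 3)"
    proof (induction k rule: dec_induct)
      case (step n)
      then show ?case
        using \<open>\<And>k. k \<in> {2..N} \<Longrightarrow> cmod (lam k) \<le> cmod (lam (k - 1))\<close>[of "Suc n"] by auto
    qed simp
    with that show ?thesis by simp
  qed
  have adm_iff: "adm \<epsilon> \<longleftrightarrow> coarse_denominator m1 m2 \<epsilon> \<gamma> \<noteq> 0" for \<epsilon>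
    by (simp add: adm_def admissible_def coarse_matrix_real[OF unit ip12 mu])
  have rho: "rho \<epsilon> = max \<bar>L \<epsilon> \<gamma>\<bar> (cmod (lam 3))" if "adm \<epsilon>" for \<epsilon>
    using that spectral_radius_two_level_matrix[OF \<open>N \<ge> 3\<close> unit ip12 mu lam dominated]
    by (simp add: rho_def adm_def L_def)
  have adm0: "adm 0" using m by (simp add: adm_iff coarse_denominator_def)
  have rho0: "rho 0 = \<bar>l2\<bar>"
    using l3 m by (simp add: rho[OF adm0] L_def lambda_fun_at_zero)

  \<comment> \<open>As \<open>cmod (lam 3) < \<bar>l2\<bar>\<close>, minimality at \<open>0\<close> amounts to \<open>\<bar>l2\<bar> \<le> \<bar>L \<epsilon> 0\<bar>\<close>.\<close>
  have orthogonal_same_sign: "is_arg_min rho adm 0"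
    if "\<gamma> = 0" "(l1 > l2 \<and> l2 > 0) \<or> (0 > l2 \<and> l2 > l1)"
    using lambda_fun_orthogonal_lower_bound[OF m(1) that(2)] \<open>\<gamma> = 0\<close> adm0
    by (auto simp: is_arg_min_def rho0 rho L_def not_less le_max_iff_disj)
  \<comment> \<open>At a zero of \<open>L\<close> the lower bound \<open>cmod (lam 3)\<close> of \<open>rho\<close> is attained.\<close>
  have opposite_sign:
    "\<exists>\<epsilon>'. \<epsilon>' \<noteq> 0 \<and> is_arg_min rho adm \<epsilon>' \<and> rho \<epsilon>' = cmod (lam 3) \<and> adm 0 \<and> rho \<epsilon>' < rho 0"
    if "(l2 > 0 \<and> 0 > l1) \<or> (l1 > 0 \<and> 0 > l2)"
  proof -
    have "l1 * l2 < 0" using that by (auto simp: mult_less_0_iff)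
    then obtain \<epsilon>' where "\<epsilon>' \<noteq> 0" "adm \<epsilon>'" "L \<epsilon>' \<gamma> = 0"
      using lambda_fun_nontrivial_zero[OF m(1) _ \<gamma>] by (auto simp: adm_iff L_def)
    moreover from this have "rho \<epsilon>' = cmod (lam 3)" by (simp add: rho)
    moreover have "cmod (lam 3) \<le> rho \<epsilon>" if "adm \<epsilon>" for \<epsilon> using rho[OF that] by simp
    ultimately show ?thesis
      using adm0 rho0 l3 by (intro exI[of _ \<epsilon>']) (auto simp: is_arg_min_def not_less)
  qed
  have oblique_same_sign:
    "\<exists>\<epsilon>'. \<epsilon>' \<noteq> 0 \<and> adm \<epsilon>' \<and> \<bar>L \<epsilon>' \<gamma>\<bar> < \<bar>l2\<bar> \<and>
       rho \<epsilon>' = max \<bar>L \<epsilon>' \<gamma>\<bar> (cmod (lam 3)) \<and> adm 0 \<and> rho \<epsilon>' < rho 0"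
    if "\<gamma> \<noteq> 0" "(l1 > l2 \<and> l2 > 0) \<or> (0 > l2 \<and> l2 > l1)"
  proof -
    have "l1 \<noteq> l2" "l2 \<noteq> 0" using that(2) by auto
    then obtain \<epsilon>' where "\<epsilon>' \<noteq> 0" "adm \<epsilon>'" "\<bar>L \<epsilon>' \<gamma>\<bar> < \<bar>l2\<bar>"
      using lambda_fun_decrease_near_zero[OF m(2,3) _ _ \<open>\<gamma> \<noteq> 0\<close>] by (auto simp: adm_iff L_def)
    then show ?thesis
      using adm0 rho0 l3 rho by (intro exI[of _ \<epsilon>']) auto
  qed
  have pole: "filterlim (\<lambda>g. L \<epsilon> g) at_infinity (at (gamma_star m1 m2 \<epsilon>))"
    if "\<epsilon> \<noteq> 0" "\<epsilon>\<^sup>2 \<noteq> 1" "l1 \<noteq> l2" for \<epsilon>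
    using lambda_fun_pole[OF m(1) that] by (simp add: L_def)
  show ?thesis
    by (intro conjI allI impI;
        (rule rho orthogonal_same_sign opposite_sign oblique_same_sign pole
          pole_neighbourhood_avoids_unit_interval[OF pole]; assumption))
qed

end
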